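(* Let $n\geq 0$ be an integer and $q\geq 7$ an odd prime power. Let $\mathcal{B}$ be a non-degenerate symmetric bilinear form on $\mathbb{F}_q^n$, and let $S\subset \mathbb{F}_q^n$ be $(3,2)$-orthogonal with respect to $\mathcal{B}$. Then \[ |S| \leq \begin{cases} 2q^{\frac{n-1}{2}}+1, &\text{if } n \text{ is odd};\\ 2q^{\frac{n}{2}}-2, &\text{if } n \text{ is even and } \varepsilon(\mathcal{B}) = 1; \\ 2q^{\frac{n}{2}-1}+ 4, &\text{if } n\geq 4 \text{ is even and } \varepsilon(\mathcal{B}) = \gamma ; \\ 4, &\text{if } n=2 \text{ and } \varepsilon(\mathcal{B}) = \gamma .\end{cases} \]
   Context: $\mathbb{F}_q$ is the finite field with $q$ elements. A bilinear form on $\mathbb{F}_q^n$ is $\mathcal{B}(\bm{x},\bm{y})=\bm{x}^TA\bm{y}$ for an $n\times n$ matrix $A$ over $\mathbb{F}_q$; it is symmetric if $A$ is symmetric and non-degenerate if $\det(A)\neq 0$. Fix a non-square $\gamma\in\mathbb{F}_q$ and let $k=\lfloor n/2\rfloor$. For non-degenerate $\mathcal{B}$, $\varepsilon(\mathcal{B})=1$ if either $k$ is even and $\det(A)$ is a square, or $k$ is odd and $-\det(A)$ is a square; otherwise $\varepsilon(\mathcal{B})=\gamma$. Two nonzero vectors $\bm{v}_1,\bm{v}_2$ are (mutually) orthogonal if $\mathcal{B}(\bm{v}_1,\bm{v}_2)=0$. A set $S\subset\mathbb{F}_q^n\setminus\{\bm{0}\}$ is $(3,2)$-orthogonal if among any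 three distinct elements of $S$ at least two are mutually orthogonal. *)

theory Defs
  imports
    "Jordan_Normal_Form.Determinant"
    "HOL-Computational_Algebra.Nth_Powers"
    "HOL-Library.Cardinality"
begin

text \<open>
  A bilinear form on $F^n$ is given by its $n \times n$ matrix \<open>A\<close>, which the form determines
  uniquely. The field with \<open>q\<close> elements is a type of class \<open>field\<close> and \<open>finite\<close> with \<open>CARD('a) = q\<close>.
\<close>

definition bilin :: "'a::field mat \<Rightarrow> 'a vec \<Rightarrow> 'a vec \<Rightarrow> 'a" where
  "bilin A x y = x \<bullet> (A *\<^sub>v y)"

definition nondegenerate_symmetric :: "nat \<Rightarrow> 'a::field mat \<Rightarrow> bool" where
  "nondegenerate_symmetric n A \<longleftrightarrow>
     A \<in> carrier_mat n n \<and> transpose_mat A = A \<and> det A \<noteq> 0"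

definition form_eps :: "'a::field \<Rightarrow> nat \<Rightarrow> 'a mat \<Rightarrow> 'a" where
  "form_eps \<gamma> n A =
     (let k = n div 2 in
      if (even k \<and> is_square (det A)) \<or> (odd k \<and> is_square (- det A)) then 1 else \<gamma>)"

definition orthogonal_vecs :: "nat \<Rightarrow> 'a::field mat \<Rightarrow> 'a vec \<Rightarrow> 'a vec \<Rightarrow> bool" where
  "orthogonal_vecs n A v w \<longleftrightarrow>
     v \<in> carrier_vec n - {0\<^sub>v n} \<and> w \<in> carrier_vec n - {0\<^sub>v n} \<and> bilin A v w = 0"

definition three_two_orthogonal :: "nat \<Rightarrow> 'a::field mat \<Rightarrow> 'a vec set \<Rightarrow> bool" where
  "three_two_orthogonal n A S \<longleftrightarrow>
     S \<subseteq> carrier_vec n - {0\<^sub>v n} \<and>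
     (\<forall>u\<in>S. \<forall>v\<in>S. \<forall>w\<in>S. u \<noteq> v \<and> u \<noteq> w \<and> v \<noteq> w \<longrightarrow>
        orthogonal_vecs n A u v \<or> orthogonal_vecs n A u w \<or> orthogonal_vecs n A v w)"

end

theory Submission
  imports Defs
begin

text \<open>
  Non-orthogonality is a triangle-free graph on \<open>S\<close>, so all neighbours of a vertex are mutually
  orthogonal. Write \<open>n = 2w + c\<close> where \<open>w\<close> bounds the dimension of the totally isotropic
  subspaces and \<open>c \<le> 2\<close>, and split \<open>S\<close> into its isotropic part \<open>Z\<close> and its non-isotropic part
  \<open>X\<close>. Splitting off a hyperbolic plane spanned by two non-orthogonal vectors of \<open>Z\<close> gives
  \<open>|Z| \<le> 2q\<^sup>w - 2\<close> by induction. If \<open>|Z|\<close> is close to this bound, then \<open>Z\<close> nearly fills two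
  isotropic subspaces \<open>U1\<close>, \<open>U2\<close> of dimension \<open>w\<close>, every vector of \<open>X\<close> is orthogonal to \<open>U1\<close> or \<open>U2\<close>,
  and counting in the \<open>c\<close>-dimensional quotients of \<open>Ui\<^sup>\<bottom>\<close> by \<open>Ui\<close> gives \<open>|X| \<le> 3c\<close>; otherwise the loss in
  \<open>|Z|\<close> exceeds a Ramsey-type bound on \<open>|X|\<close> that is quadratic in \<open>n\<close>. In all cases
  \<open>|S| \<le> 2q\<^sup>w - 2 + 3c\<close>. Dimensions are measured by cardinalities throughout. Finally, an
  isotropic subspace of dimension \<open>n/2\<close> forces \<open>(-1)\<^bsup>n/2\<^esup> det A\<close> to be a square.
\<close>

lemma card_carrier_vec_field:
  "finite (carrier_vec n :: 'a::finite vec set)"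
  "card (carrier_vec n :: 'a::finite vec set) = CARD('a) ^ n"
proof -
  let ?L = "{xs :: 'a list. set xs \<subseteq> UNIV \<and> length xs = n}"
  have 1: "vec_of_list \<in> ?L \<rightarrow> carrier_vec n" by (intro funcsetI carrier_vecI) simp
  have 2: "list_of_vec \<in> carrier_vec n \<rightarrow> ?L" by (intro funcsetI) simp
  have *: "bij_betw vec_of_list ?L (carrier_vec n)"
    by (rule bij_betwI[OF 1 2]) (simp_all only: vec_list list_vec)
  have "finite ?L" by (rule finite_lists_length_eq) (rule finite)
  then show "finite (carrier_vec n :: 'a vec set)"
    by (simp only: bij_betw_finite[OF *])
  have "card ?L = CARD('a) ^ n" by (rule card_lists_length_eq) (rule finite)
  then show "card (carrier_vec n :: 'a vec set) = CARD('a) ^ n"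
    by (simp only: bij_betw_same_card[OF *])
qed

text \<open>Lets the quadratic bounds on non-isotropic vectors be absorbed by powers of
  \<open>q\<close>, where 7 is the least value of \<open>q\<close> considered. Equality holds at
  \<open>k = 1\<close>.\<close>

lemma quadratic_le_power_7:
  "k \<ge> 1 \<Longrightarrow> 4 * (k * k) + 22 * k + 30 \<le> 8 * 7 ^ k" for k :: nat
proof (induction k rule: dec_induct)
  case (step k)
  have "4 * (Suc k * Suc k) + 22 * Suc k + 30 \<le> 7 * (4 * (k * k) + 22 * k + 30)"
    by (simp add: algebra_simps)
  also have "\<dots> \<le> 7 * (8 * 7 ^ k)" using step.IH by (rule mult_le_mono2)
  finally show ?case by simp
qed simp

section \<open>The form, its subspaces, spans and orthogonal complements\<close>

locale bilinear_space =
  fixes n q :: nat and A :: "'a::{field,finite} mat"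
  assumes card_field: "CARD('a) = q"
    and nondegenerate: "nondegenerate_symmetric n A"
begin

abbreviation V :: "'a vec set" where "V \<equiv> carrier_vec n"
abbreviation B :: "'a vec \<Rightarrow> 'a vec \<Rightarrow> 'a" where "B \<equiv> bilin A"

lemma A_carrier: "A \<in> carrier_mat n n"
  using nondegenerate by (simp add: nondegenerate_symmetric_def)

lemma B_sym: "x \<in> V \<Longrightarrow> y \<in> V \<Longrightarrow> B x y = B y x"
  unfolding bilin_def
  using nondegenerate transpose_vec_mult_scalar[OF A_carrier, of y x]
    comm_scalar_prod[of x n "A *\<^sub>v y"] comm_scalar_prod[of y n "A *\<^sub>v x"] A_carrier
  by (auto simp: nondegenerate_symmetric_def)

lemma B_add_left: "x \<in> V \<Longrightarrow> y \<in> V \<Longrightarrow> z \<in> V \<Longrightarrow> B (x + y) z = B x z + B y z"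
  unfolding bilin_def using A_carrier by (intro add_scalar_prod_distrib) auto

lemma B_smult_left: "x \<in> V \<Longrightarrow> z \<in> V \<Longrightarrow> B (a \<cdot>\<^sub>v x) z = a * B x z"
  unfolding bilin_def using A_carrier by (intro smult_scalar_prod_distrib) auto

lemma B_add_right: "x \<in> V \<Longrightarrow> y \<in> V \<Longrightarrow> z \<in> V \<Longrightarrow> B x (y + z) = B x y + B x z"
  using B_add_left[of y z x] by (simp add: B_sym[of x])

lemma B_smult_right: "x \<in> V \<Longrightarrow> z \<in> V \<Longrightarrow> B x (a \<cdot>\<^sub>v z) = a * B x z"
  using B_smult_left[of z x a] by (simp add: B_sym[of x])

lemma B_zero_left: "x \<in> V \<Longrightarrow> B (0\<^sub>v n) x = 0"
  unfolding bilin_def using A_carrier by (intro scalar_prod_left_zero) auto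

lemma B_zero_right: "x \<in> V \<Longrightarrow> B x (0\<^sub>v n) = 0"
  by (simp add: B_sym[of x] B_zero_left)

lemmas B_simps = B_add_left B_add_right B_smult_left B_smult_right B_zero_left B_zero_right

lemma nondeg:
  assumes "v \<in> V" "v \<noteq> 0\<^sub>v n"
  obtains u where "u \<in> V" "B v u \<noteq> 0"
proof -
  have "A *\<^sub>v v \<noteq> 0\<^sub>v n"
    using nondegenerate det_0_iff_vec_prod_zero[OF A_carrier] assms
    by (auto simp: nondegenerate_symmetric_def)
  then obtain i where i: "i < n" "(A *\<^sub>v v) $ i \<noteq> 0"
    using A_carrier by (metis carrier_matD(1) dim_mult_mat_vec eq_vecI index_zero_vec)
  have "B (unit_vec n i) v = (A *\<^sub>v v) $ i"
    unfolding bilin_def using A_carrier assms i by (intro scalar_prod_left_unit) auto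
  with i have "B v (unit_vec n i) \<noteq> 0"
    using assms by (simp add: B_sym[of v])
  then show thesis using that[of "unit_vec n i"] by simp
qed

definition subspace :: "'a vec set \<Rightarrow> bool" where
  "subspace W \<longleftrightarrow> W \<subseteq> V \<and> 0\<^sub>v n \<in> W \<and> (\<forall>x\<in>W. \<forall>y\<in>W. x + y \<in> W) \<and> (\<forall>a. \<forall>x\<in>W. a \<cdot>\<^sub>v x \<in> W)"

text \<open>Defined as an intersection so that facts pass from \<open>M\<close> to its span by
  minimality, without linear combinations or bases. Only for \<open>M\<close> inside
  \<open>V\<close> is the family nonempty.\<close>

definition span :: "'a vec set \<Rightarrow> 'a vec set" where
  "span M = \<Inter>{W. subspace W \<and> M \<subseteq> W}"

definition perp :: "'a vec set \<Rightarrow> 'a vec set" where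
  "perp M = {v \<in> V. \<forall>x\<in>M. B x v = 0}"

definition isotropic :: "'a vec set \<Rightarrow> bool" where
  "isotropic M \<longleftrightarrow> M \<subseteq> V \<and> (\<forall>x\<in>M. \<forall>y\<in>M. B x y = 0)"

text \<open>This is (3,2)-orthogonality read as a graph condition. The zero vector is allowed here
  and is excluded by a separate hypothesis where the counts depend on it.\<close>

definition triangle_free :: "'a vec set \<Rightarrow> bool" where
  "triangle_free S \<longleftrightarrow> S \<subseteq> V \<and> (\<forall>u\<in>S. \<forall>v\<in>S. \<forall>w\<in>S. u \<noteq> v \<and> u \<noteq> w \<and> v \<noteq> w \<longrightarrow>
     B u v = 0 \<or> B u w = 0 \<or> B v w = 0)"

lemma V_subspace: "subspace V"
  by (auto simp: subspace_def)

lemma subspaceD: "subspace W \<Longrightarrow> W \<subseteq> V" "subspace W \<Longrightarrow> 0\<^sub>v n \<in> W"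
  by (auto simp: subspace_def)

lemma finite_subspace: "subspace W \<Longrightarrow> finite W"
  using card_carrier_vec_field(1) finite_subset by (auto simp: subspace_def)

lemma finite_V: "M \<subseteq> V \<Longrightarrow> finite M"
  using card_carrier_vec_field(1) finite_subset by blast

lemma subspace_Int: "subspace W \<Longrightarrow> subspace W' \<Longrightarrow> subspace (W \<inter> W')"
  by (auto simp: subspace_def)

lemma subspace_perp: "M \<subseteq> V \<Longrightarrow> subspace (perp M)"
  by (auto simp: subspace_def perp_def B_simps subset_iff)

lemma span_subspace: "M \<subseteq> V \<Longrightarrow> subspace (span M)"
  using V_subspace unfolding span_def subspace_def by blast

lemma span_superset: "M \<subseteq> span M"
  by (auto simp: span_def)

lemma span_minimal: "subspace W \<Longrightarrow> M \<subseteq> W \<Longrightarrow> span M \<subseteq> W"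
  by (auto simp: span_def)

lemma subset_perp_sym: "M \<subseteq> V \<Longrightarrow> N \<subseteq> V \<Longrightarrow> M \<subseteq> perp N \<longleftrightarrow> N \<subseteq> perp M"
  unfolding perp_def subset_iff mem_Collect_eq using B_sym by metis

lemma isotropic_iff: "isotropic M \<longleftrightarrow> M \<subseteq> V \<and> M \<subseteq> perp M"
  by (auto simp: isotropic_def perp_def subset_iff)

text \<open>Minimality of the span is applied once in each argument of the form, with
  \<open>subset_perp_sym\<close> exchanging the two arguments in between.\<close>

lemma span_isotropic:
  assumes "isotropic M" shows "isotropic (span M)"
proof -
  have M: "M \<subseteq> V" "M \<subseteq> perp M" using assms by (auto simp: isotropic_iff)
  have sV: "span M \<subseteq> V" using span_subspace[OF M(1)] subspaceD by blast
  have "span M \<subseteq> perp M" using M subspace_perp span_minimal by blast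
  then have "M \<subseteq> perp (span M)" using subset_perp_sym M sV by blast
  then have "span M \<subseteq> perp (span M)" using sV subspace_perp span_minimal by blast
  then show ?thesis using sV by (simp add: isotropic_iff)
qed

lemma perp_antimono: "M \<subseteq> N \<Longrightarrow> perp N \<subseteq> perp M"
  by (auto simp: perp_def)

lemma perp_span:
  assumes "M \<subseteq> V" shows "perp (span M) = perp M"
proof
  show "perp (span M) \<subseteq> perp M" by (rule perp_antimono[OF span_superset])
  have p: "perp M \<subseteq> V" by (auto simp: perp_def)
  have "M \<subseteq> perp (perp M)" using subset_perp_sym[OF assms p] by simp
  then have "span M \<subseteq> perp (perp M)" by (rule span_minimal[OF subspace_perp[OF p]])
  then show "perp M \<subseteq> perp (span M)"
    using subset_perp_sym[OF _ p] subspaceD(1)[OF span_subspace[OF assms]] by blast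
qed

section \<open>Dimension counting by cardinalities\<close>

text \<open>Each \<open>y\<close> in \<open>W\<close> is uniquely
  \<open>v + a \<cdot>\<^sub>v w\<close> with \<open>v\<close> orthogonal to \<open>x\<close>,
  namely with \<open>a = B x y / B x w\<close>. This replaces the statement that the kernel of a
  nonzero functional has codimension one.\<close>

lemma card_hyperplane:
  assumes W: "subspace W" and x: "x \<in> V" and w: "w \<in> W" "B x w \<noteq> 0"
  shows "card W = q * card (W \<inter> perp {x})"
proof -
  have WV: "W \<subseteq> V" using W subspaceD by blast
  have cl: "v + a \<cdot>\<^sub>v w \<in> W" if "v \<in> W" for v a
    using W w that by (auto simp: subspace_def)
  let ?f = "\<lambda>(a, v). v + a \<cdot>\<^sub>v w"
  let ?g = "\<lambda>y. (B x y / B x w, y + (- (B x y / B x w)) \<cdot>\<^sub>v w)"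
  have wV: "w \<in> V" using w WV by blast
  have cancel: "(v + a \<cdot>\<^sub>v w) + b \<cdot>\<^sub>v w = v" if "v \<in> V" "a + b = 0" for v a b
  proof -
    have "(v + a \<cdot>\<^sub>v w) + b \<cdot>\<^sub>v w = v + (a + b) \<cdot>\<^sub>v w"
      using that wV add_smult_distrib_vec[of a b w] by (simp add: assoc_add_vec[of v n])
    also have "\<dots> = v" using that wV by (intro eq_vecI) auto
    finally show ?thesis .
  qed
  have "bij_betw ?f (UNIV \<times> (W \<inter> perp {x})) W"
  proof (rule bij_betwI[where g = ?g])
    show "?f \<in> UNIV \<times> (W \<inter> perp {x}) \<rightarrow> W" using cl by auto
    show "?g \<in> W \<rightarrow> UNIV \<times> (W \<inter> perp {x})"
    proof
      fix y assume y: "y \<in> W"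
      then have yV: "y \<in> V" using WV by blast
      have "B x (y + (- (B x y / B x w)) \<cdot>\<^sub>v w) = 0"
        using x yV wV w by (simp add: B_add_right B_smult_right)
      then show "?g y \<in> UNIV \<times> (W \<inter> perp {x})"
        using cl[OF y] WV by (auto simp: perp_def)
    qed
    show "?f (?g y) = y" if "y \<in> W" for y
      using cancel that WV by auto
    show "?g (?f p) = p" if "p \<in> UNIV \<times> (W \<inter> perp {x})" for p
    proof -
      obtain a v where "p = (a, v)" by (cases p)
      with that have p: "p = (a, v)" "v \<in> W" "v \<in> V" "B x v = 0"
        by (auto simp: perp_def)
      have "B x (v + a \<cdot>\<^sub>v w) / B x w = a"
        using p x wV w by (simp add: B_add_right B_smult_right)
      then show ?thesis using p cancel[of v a "-a"] by simp
    qed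
  qed
  then show ?thesis
    using card_field by (metis bij_betw_same_card card_cartesian_product)
qed

lemma q_ge_2: "q \<ge> 2"
proof -
  have "card {0, 1 :: 'a} \<le> CARD('a)" by (rule card_mono) auto
  then show ?thesis by (simp add: card_field)
qed

lemma card_subspace_pos: "subspace W \<Longrightarrow> card W > 0"
  using finite_subspace subspaceD(2) by (auto simp: card_gt_0_iff)

text \<open>Non-degeneracy supplies a functional \<open>B u\<close> that does not vanish on a given
  nonzero subspace; passing to its kernel divides the cardinality by \<open>q\<close>.\<close>

lemma card_subspace_power:
  assumes "subspace W" shows "\<exists>k. card W = q ^ k"
  using assms
proof (induction "card W" arbitrary: W rule: less_induct)
  case less
  show ?case
  proof (cases "W = {0\<^sub>v n}")
    case True
    then show ?thesis by (intro exI[of _ 0]) simp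
  next
    case False
    then obtain w where w: "w \<in> W" "w \<noteq> 0\<^sub>v n" "w \<in> V"
      using less.prems by (auto simp: subspace_def)
    obtain u where u: "u \<in> V" "B w u \<noteq> 0" using nondeg w by blast
    let ?W = "W \<inter> perp {u}"
    have sub: "subspace ?W" using less.prems subspace_Int subspace_perp u by blast
    have c: "card W = q * card ?W"
      using card_hyperplane[OF less.prems u(1) w(1)] u w B_sym by simp
    have "card ?W < card W"
      using c q_ge_2 card_subspace_pos[OF sub] by simp
    with less.hyps sub obtain k where "card ?W = q ^ k" by blast
    with c show ?thesis by (intro exI[of _ "Suc k"]) simp
  qed
qed

text \<open>Both sides count the orthogonal pairs in \<open>U \<times> V\<close>, up to a common factor.\<close>

lemma card_perp:
  assumes U: "subspace U" shows "card U * card (perp U) = q ^ n"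
proof -
  let ?P = "{p \<in> U \<times> V. B (fst p) (snd p) = 0}"
  have fU: "finite U" using U finite_subspace by blast
  have fV: "finite V" using finite_V by blast
  have UV: "U \<subseteq> V" using U subspaceD by blast
  have cV: "card V = q ^ n" by (simp add: card_carrier_vec_field card_field)
  have z: "0\<^sub>v n \<in> U" using U subspaceD by blast
  have pU: "perp U \<subseteq> V" by (auto simp: perp_def)
  \<comment> \<open>Summing over \<open>u\<close> first: the zero vector contributes all of
    \<open>V\<close>, every other \<open>u\<close> a hyperplane of \<open>V\<close>. The factor
    \<open>q\<close> avoids division.\<close>
  have "?P = (SIGMA u:U. V \<inter> perp {u})" by (auto simp: perp_def)
  then have "card ?P = (\<Sum>u\<in>U. card (V \<inter> perp {u}))" using fU fV by simp
  then have "q * card ?P = (\<Sum>u\<in>U. q * card (V \<inter> perp {u}))" by (simp add: sum_distrib_left)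
  also have "\<dots> = q * card (V \<inter> perp {0\<^sub>v n}) + (\<Sum>u\<in>U - {0\<^sub>v n}. q * card (V \<inter> perp {u}))"
    by (rule sum.remove[OF fU z])
  also have "V \<inter> perp {0\<^sub>v n} = V" by (auto simp: perp_def B_zero_left)
  also have "(\<Sum>u\<in>U - {0\<^sub>v n}. q * card (V \<inter> perp {u})) = (\<Sum>u\<in>U - {0\<^sub>v n}. q ^ n)"
  proof (rule sum.cong[OF refl])
    fix u assume "u \<in> U - {0\<^sub>v n}"
    then have u: "u \<in> V" "u \<noteq> 0\<^sub>v n" using UV by auto
    then obtain w where "w \<in> V" "B u w \<noteq> 0" using nondeg by blast
    then show "q * card (V \<inter> perp {u}) = q ^ n"
      using card_hyperplane[OF V_subspace u(1)] cV by simp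
  qed
  also have "\<dots> = (card U - 1) * q ^ n" using fU z by simp
  finally have 1: "q * card ?P = q * q ^ n + (card U - 1) * q ^ n" using cV by simp
  \<comment> \<open>Summing over \<open>v\<close> first: a vector of \<open>perp U\<close>
    contributes all of \<open>U\<close>, every other \<open>v\<close> a hyperplane of
    \<open>U\<close>.\<close>
  have "card ?P = card (SIGMA v:V. U \<inter> perp {v})"
    by (rule bij_betw_same_card[where f = prod.swap], rule bij_betwI[where g = prod.swap])
       (use UV in \<open>auto simp: perp_def B_sym\<close>)
  then have "card ?P = (\<Sum>v\<in>V. card (U \<inter> perp {v}))" using fU fV by simp
  then have "q * card ?P = (\<Sum>v\<in>V. q * card (U \<inter> perp {v}))" by (simp add: sum_distrib_left)
  also have "\<dots> = (\<Sum>v\<in>V - perp U. q * card (U \<inter> perp {v})) + (\<Sum>v\<in>perp U. q * card (U \<inter> perp {v}))"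
    by (rule sum.subset_diff[OF pU fV])
  also have "(\<Sum>v\<in>perp U. q * card (U \<inter> perp {v})) = (\<Sum>v\<in>perp U. q * card U)"
  proof (rule sum.cong[OF refl])
    fix v assume "v \<in> perp U"
    then have "U \<inter> perp {v} = U" using UV by (auto simp: perp_def B_sym)
    then show "q * card (U \<inter> perp {v}) = q * card U" by simp
  qed
  also have "(\<Sum>v\<in>V - perp U. q * card (U \<inter> perp {v})) = (\<Sum>v\<in>V - perp U. card U)"
  proof (rule sum.cong[OF refl])
    fix v assume v: "v \<in> V - perp U"
    then obtain u where "u \<in> U" "B u v \<noteq> 0" by (auto simp: perp_def)
    then show "q * card (U \<inter> perp {v}) = card U"
      using card_hyperplane[OF U, of v u] v UV by (auto simp: B_sym subset_iff)
  qed
  finally have 2: "q * card ?P = (card V - card (perp U)) * card U + card (perp U) * (q * card U)"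
    using card_Diff_subset[OF finite_V[OF pU] pU] by simp
  have le: "card (perp U) \<le> card V" using card_mono[OF fV pU] .
  have pos: "card U \<ge> 1" using card_subspace_pos[OF U] by simp
  \<comment> \<open>Over the integers the truncated subtractions become genuine ones, and the factor
    \<open>r - 1\<close>, nonzero since \<open>q\<close> is at least 2, cancels.\<close>
  define a b c r where "a = int (card U)" and "b = int (card (perp U))" and "c = int (q ^ n)" and "r = int q"
  have "r * c + (a - 1) * c = (c - b) * a + b * (r * a)"
    using arg_cong[OF 1[unfolded 2], of int] le pos cV
    unfolding a_def b_def c_def r_def by (simp add: of_nat_diff)
  then have "(r - 1) * (a * b) = (r - 1) * c" by (simp add: algebra_simps)
  then have "a * b = c" using q_ge_2 unfolding r_def by auto
  then show ?thesis unfolding a_def b_def c_def by (metis of_nat_eq_iff of_nat_mult)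
qed

section \<open>Witt index and bounds for non-isotropic vectors\<close>

text \<open>Bounds the Witt index of \<open>W\<close> by \<open>w\<close>, with dimensions again
  read off from cardinalities.\<close>

definition witt_le :: "'a vec set \<Rightarrow> nat \<Rightarrow> bool" where
  "witt_le W w \<longleftrightarrow> (\<forall>U. subspace U \<and> isotropic U \<and> U \<subseteq> W \<longrightarrow> card U \<le> q ^ w)"

lemma triangle_free_subset: "triangle_free S \<Longrightarrow> T \<subseteq> S \<Longrightarrow> triangle_free T"
  unfolding triangle_free_def by blast

lemma triangle_freeD:
  "triangle_free S \<Longrightarrow> u \<in> S \<Longrightarrow> v \<in> S \<Longrightarrow> w \<in> S \<Longrightarrow> u \<noteq> v \<Longrightarrow> u \<noteq> w \<Longrightarrow> v \<noteq> w \<Longrightarrow>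
     B u v = 0 \<or> B u w = 0 \<or> B v w = 0"
  unfolding triangle_free_def by blast

text \<open>Restricting \<open>W\<close> to the complement of a non-isotropic \<open>x\<close> in
  \<open>X\<close> costs a factor \<open>q\<close> and loses neither \<open>U\<close> nor the rest
  of \<open>X\<close>. So \<open>X\<close> is independent modulo \<open>U\<close>, which in the
  applications lies in the radical of \<open>W\<close>.\<close>

lemma card_orthogonal_nonisotropic:
  assumes "finite X" "subspace W" "X \<subseteq> W" "subspace U" "U \<subseteq> W" "X \<subseteq> perp U"
    and "\<And>x. x \<in> X \<Longrightarrow> B x x \<noteq> 0"
    and "\<And>x y. x \<in> X \<Longrightarrow> y \<in> X \<Longrightarrow> x \<noteq> y \<Longrightarrow> B x y = 0"
  shows "card U * q ^ card X \<le> card W"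
  using assms
proof (induction X arbitrary: W rule: finite_induct)
  case empty
  then show ?case using card_mono[of W U] finite_subspace[of W] by simp
next
  case (insert x X)
  note prems = insert.prems
  have x: "x \<in> V" "x \<in> W" using prems(1,2) subspaceD(1) by auto
  have xx: "B x x \<noteq> 0" by (rule prems(6)) simp
  have UV: "U \<subseteq> V" using prems(3) by (rule subspaceD)
  let ?W = "W \<inter> perp {x}"
  have "x \<in> perp U" using prems(5) by simp
  then have Ux: "U \<subseteq> perp {x}" using subset_perp_sym[of U "{x}"] UV x by simp
  have Xx: "B x y = 0" if "y \<in> X" for y
    by (rule prems(7)) (use that insert.hyps in auto)
  have "card U * q ^ card X \<le> card ?W"
  proof (rule insert.IH)
    show "subspace ?W" using subspace_Int prems(1) subspace_perp[of "{x}"] x by simp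
    show "X \<subseteq> ?W" using prems(1,2) Xx subspaceD(1) by (fastforce simp: perp_def)
    show "U \<subseteq> ?W" using prems(4) Ux by simp
  qed (use prems in simp_all)
  moreover have "card W = q * card ?W" by (rule card_hyperplane[OF prems(1) x xx])
  ultimately show ?case using insert.hyps by simp
qed

lemma card_orthogonal_nonisotropic_le:
  assumes "X \<subseteq> V" "subspace W" "X \<subseteq> W" "subspace U" "U \<subseteq> W" "X \<subseteq> perp U"
    and "\<And>x. x \<in> X \<Longrightarrow> B x x \<noteq> 0"
    and "\<And>x y. x \<in> X \<Longrightarrow> y \<in> X \<Longrightarrow> x \<noteq> y \<Longrightarrow> B x y = 0"
    and W: "card W \<le> card U * q ^ m"
  shows "card X \<le> m"
proof -
  have "card U * q ^ card X \<le> card W"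
    by (rule card_orthogonal_nonisotropic[OF finite_V[OF assms(1)] assms(2-8)])
  then have "card U * q ^ card X \<le> card U * q ^ m" using W by (rule le_trans)
  then have "q ^ card X \<le> q ^ m" using card_subspace_pos[OF assms(4)] by (simp only: mult_le_cancel1)
  then show ?thesis using q_ge_2 by (simp add: power_le_imp_le_exp)
qed

lemma triangle_free_neighbours:
  assumes "triangle_free S" "x \<in> S" "y \<in> S" "z \<in> S" "y \<noteq> z" "x \<noteq> y" "x \<noteq> z" "B x y \<noteq> 0" "B x z \<noteq> 0"
  shows "B y z = 0"
  using triangle_freeD[of S x y z] assms by blast

text \<open>The Ramsey-type bound, by induction on the codimension \<open>m\<close> of
  \<open>U\<close> in \<open>W\<close>. The neighbours of a vector \<open>x\<close> are mutually
  orthogonal, so there are at most \<open>Suc m\<close> of them in the inductive step; all other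
  vectors lie in the complement of \<open>x\<close>, of codimension \<open>m\<close>. Hence the
  bound grows by \<open>m + 2\<close>.\<close>

lemma card_triangle_free_nonisotropic:
  assumes "triangle_free X" "subspace W" "X \<subseteq> W" "subspace U" "U \<subseteq> W" "X \<subseteq> perp U"
    and "\<And>x. x \<in> X \<Longrightarrow> B x x \<noteq> 0"
    and "card W \<le> card U * q ^ m"
  shows "2 * card X \<le> m * (m + 3)"
  using assms
proof (induction m arbitrary: X W)
  case 0
  have "X = {}"
  proof (rule ccontr)
    assume "X \<noteq> {}"
    then obtain x where x: "x \<in> X" by blast
    have "card {x} \<le> 0"
      by (rule card_orthogonal_nonisotropic_le[of _ W U]) (use 0 x subspaceD in blast)+
    then show False by simp
  qed
  then show ?case by simp
next
  case (Suc m)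
  have XV: "X \<subseteq> V" using Suc.prems(1) by (simp add: triangle_free_def)
  show ?case
  proof (cases "X = {}")
    case False
    then obtain x where x: "x \<in> X" by blast
    have xV: "x \<in> V" "B x x \<noteq> 0" using x XV Suc.prems by blast+
    let ?N = "{y \<in> X. y \<noteq> x \<and> B x y \<noteq> 0}" and ?W = "W \<inter> perp {x}"
    let ?X = "X \<inter> perp {x}"
    have UV: "U \<subseteq> V" using Suc.prems subspaceD by blast
    have "card ?N \<le> Suc m"
      by (rule card_orthogonal_nonisotropic_le[of _ W U])
         (use Suc.prems XV triangle_free_neighbours[OF Suc.prems(1) x] in auto)
    moreover have "2 * card ?X \<le> m * (m + 3)"
    proof (rule Suc.IH[of _ ?W])
      show "triangle_free ?X" using Suc.prems(1) triangle_free_subset by blast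
      show "subspace ?W" using subspace_Int Suc.prems(2) subspace_perp xV by auto
      show "U \<subseteq> ?W"
        using Suc.prems subset_perp_sym[of U "{x}"] UV x xV by auto
      have "card W = q * card ?W" using card_hyperplane Suc.prems(2,3) x xV by blast
      then show "card ?W \<le> card U * q ^ m" using Suc.prems(8) q_ge_2 by simp
    qed (use Suc.prems in auto)
    moreover have "X = insert x (?N \<union> ?X)" using x XV by (auto simp: perp_def)
    then have "card X \<le> Suc (card (?N \<union> ?X))"
      using card_insert_le_m1[of "Suc (card (?N \<union> ?X))" "?N \<union> ?X" x] by simp
    then have "card X \<le> Suc (card ?N + card ?X)" using card_Un_le[of ?N ?X] by linarith
    ultimately show ?thesis by (simp add: algebra_simps)
  qed simp
qed

text \<open>Improves the general bound, which is 5 for \<open>m = 2\<close>. Given an orthogonal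
  pair \<open>x\<close>, \<open>p\<close>, every vector is orthogonal to \<open>x\<close>,
  orthogonal to \<open>p\<close>, or a common neighbour of both. The count is 2 + 2 + 0 without
  common neighbours and 1 + 1 + 2 with them.\<close>

lemma card_triangle_free_nonisotropic_plane:
  assumes X: "triangle_free X" "subspace W" "X \<subseteq> W" "subspace U" "U \<subseteq> W" "X \<subseteq> perp U"
    and aniso: "\<And>x. x \<in> X \<Longrightarrow> B x x \<noteq> 0"
    and W: "card W \<le> card U * q ^ 2"
  shows "card X \<le> 4"
proof (cases "\<exists>x\<in>X. \<exists>p\<in>X. x \<noteq> p \<and> B x p = 0")
  case False
  have "card X \<le> 2"
  proof (rule ccontr)
    assume "\<not> card X \<le> 2"
    then obtain T where "T \<subseteq> X" "card T = 3" using obtain_subset_with_card_n[of 3 X] by auto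
    then obtain u v w where "u \<in> X" "v \<in> X" "w \<in> X" "u \<noteq> v" "u \<noteq> w" "v \<noteq> w"
      by (auto simp: card_3_iff)
    then show False using triangle_freeD[OF X(1)] False by blast
  qed
  then show ?thesis by simp
next
  case True
  have XV: "X \<subseteq> V" using X by (simp add: triangle_free_def)
  have UV: "U \<subseteq> V" using X subspaceD by blast
  have Uperp: "U \<subseteq> perp {x}" if "x \<in> X" for x
    using X that subset_perp_sym[of U "{x}"] UV XV by blast
  have orth_le: "card Y \<le> 2"
    if Y: "Y \<subseteq> X" and "\<And>y z. y \<in> Y \<Longrightarrow> z \<in> Y \<Longrightarrow> y \<noteq> z \<Longrightarrow> B y z = 0" for Y
  proof (rule card_orthogonal_nonisotropic_le[OF _ X(2) _ X(4,5) _ _ that(2) W])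
    show "Y \<subseteq> V" "Y \<subseteq> W" "Y \<subseteq> perp U" using Y X(3,6) XV by auto
    show "B y y \<noteq> 0" if "y \<in> Y" for y using that Y aniso by blast
  qed
  have perp2: "card (X \<inter> perp {x}) \<le> 2" if x: "x \<in> X" for x
  proof -
    let ?W = "W \<inter> perp {x}"
    have "card W = q * card ?W" using card_hyperplane X x XV aniso by blast
    then have "card ?W \<le> card U * q ^ 1" using W q_ge_2 by (simp add: power2_eq_square)
    then have "2 * card (X \<inter> perp {x}) \<le> 1 * (1 + 3)"
      using X x XV aniso Uperp subspace_Int[OF X(2) subspace_perp[of "{x}"]]
      by (intro card_triangle_free_nonisotropic[of _ ?W U]) (auto intro: triangle_free_subset)
    then show ?thesis by simp
  qed
  \<comment> \<open>A common neighbour \<open>t\<close> of \<open>x\<close> and \<open>p\<close>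
    makes \<open>p\<close> the only vector of \<open>X\<close> orthogonal to \<open>x\<close>. A
    second one, \<open>p'\<close>, would be adjacent to \<open>p\<close> and hence not to
    \<open>t\<close>; but \<open>p\<close> and \<open>p'\<close> are proportional modulo
    \<open>U\<close>, which would make \<open>p\<close> orthogonal to \<open>t\<close> as
    well.\<close>
  have unique: "p' = p"
    if x: "x \<in> X" and p: "p \<in> X" "B x p = 0" "x \<noteq> p" and t: "t \<in> X" "B x t \<noteq> 0" "B p t \<noteq> 0"
      and p': "p' \<in> X" "B x p' = 0" for x p t p'
  proof (rule ccontr)
    assume ne: "p' \<noteq> p"
    have V: "x \<in> V" "p \<in> V" "t \<in> V" "p' \<in> V" using XV x p t p' by auto
    have ne': "x \<noteq> p'" "t \<noteq> p" "t \<noteq> p'" using p p' t aniso x by auto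
    have 1: "B p p' \<noteq> 0"
    proof
      assume *: "B p p' = 0"
      have "B p x = 0" "B p' x = 0" "B p' p = 0"
        using * p(2) p'(2) B_sym V by metis+
      then have "B y z = 0" if "y \<in> {x, p, p'}" "z \<in> {x, p, p'}" "y \<noteq> z" for y z
        using * p p' that by blast
      then have "card {x, p, p'} \<le> 2"
        using x p p' by (intro orth_le) blast+
      then show False using ne ne' p by simp
    qed
    then have 2: "B p' t = 0" using triangle_freeD[OF X(1), of p p' t] t p p' ne ne' by auto
    \<comment> \<open>\<open>?l\<close> is the projection coefficient that makes
      \<open>p + ?l \<cdot>\<^sub>v p'\<close> orthogonal to \<open>p'\<close>. Since
      \<open>x\<close> and \<open>p'\<close> use up the codimension 2, this vector falls into
      \<open>U\<close>.\<close>
    let ?W1 = "W \<inter> perp {x}" and ?l = "- (B p' p / B p' p')"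
    let ?W2 = "?W1 \<inter> perp {p'}"
    have s1: "subspace ?W1" using subspace_Int[OF X(2) subspace_perp[of "{x}"]] V by simp
    have s2: "subspace ?W2" using subspace_Int[OF s1 subspace_perp[of "{p'}"]] V by simp
    have "card W = q * card ?W1" using card_hyperplane X x XV aniso by blast
    moreover have "p' \<in> ?W1" using p' V X by (auto simp: perp_def)
    then have "card ?W1 = q * card ?W2" using card_hyperplane[OF s1] V aniso p' by blast
    ultimately have "card ?W2 \<le> card U" using W q_ge_2 by (simp add: power2_eq_square)
    moreover have "U \<subseteq> ?W2" using X Uperp x p' by blast
    ultimately have UW: "U = ?W2" using card_seteq[OF finite_subspace[OF s2]] by blast
    have pW: "p \<in> W" "p' \<in> W" using X p p' by auto
    then have "p + ?l \<cdot>\<^sub>v p' \<in> W" using X(2) by (auto simp: subspace_def)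
    moreover have "B x (p + ?l \<cdot>\<^sub>v p') = 0" using V p p' by (simp add: B_simps)
    moreover have "B p' (p + ?l \<cdot>\<^sub>v p') = 0" using V p' aniso by (simp add: B_simps)
    ultimately have "p + ?l \<cdot>\<^sub>v p' \<in> U" using V by (subst UW) (simp add: perp_def)
    then have "B (p + ?l \<cdot>\<^sub>v p') t = 0" using X t by (auto simp: perp_def)
    then show False using V t 2 by (simp add: B_simps)
  qed
  obtain x p where x: "x \<in> X" and p: "p \<in> X" "x \<noteq> p" "B x p = 0" using True by blast
  have V: "x \<in> V" "p \<in> V" using XV x p by auto
  have px: "B p x = 0" using p V B_sym by simp
  let ?T = "{t \<in> X. B x t \<noteq> 0 \<and> B p t \<noteq> 0}"
  have "X = (X \<inter> perp {x}) \<union> (X \<inter> perp {p}) \<union> ?T" using XV by (auto simp: perp_def)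
  then have le: "card X \<le> card (X \<inter> perp {x}) + card (X \<inter> perp {p}) + card ?T"
    using card_Un_le[of "X \<inter> perp {x} \<union> X \<inter> perp {p}" ?T]
      card_Un_le[of "X \<inter> perp {x}" "X \<inter> perp {p}"] by simp
  show ?thesis
  proof (cases "?T = {}")
    case True
    then have "card ?T = 0" by (simp only: card.empty)
    then show ?thesis using le perp2[OF x] perp2[OF p(1)] by linarith
  next
    case False
    then obtain t where t: "t \<in> X" "B x t \<noteq> 0" "B p t \<noteq> 0" by blast
    have "X \<inter> perp {x} \<subseteq> {p}" using unique[OF x p(1,3,2) t] by (auto simp: perp_def)
    moreover have "X \<inter> perp {p} \<subseteq> {x}"
      using unique[OF p(1) x px p(2)[symmetric] t(1,3,2)] by (auto simp: perp_def)
    moreover have "card ?T \<le> 2"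
      using triangle_free_neighbours[OF X(1) x] px by (intro orth_le) auto
    ultimately show ?thesis
      using le card_mono[of "{p}" "X \<inter> perp {x}"] card_mono[of "{x}" "X \<inter> perp {p}"] by simp
  qed
qed

lemma card_triangle_free_nonisotropic_small:
  assumes "triangle_free X" "subspace W" "X \<subseteq> W" "subspace U" "U \<subseteq> W" "X \<subseteq> perp U"
    and "\<And>x. x \<in> X \<Longrightarrow> B x x \<noteq> 0"
    and "card W \<le> card U * q ^ m" and m: "m \<le> 2"
  shows "card X \<le> 2 * m"
proof (cases "m = 2")
  case True
  then show ?thesis using card_triangle_free_nonisotropic_plane[of X W U] assms by simp
next
  case False
  then have "m = 0 \<or> m = 1" using m by auto
  moreover have "2 * card X \<le> m * (m + 3)" by (rule card_triangle_free_nonisotropic[OF assms(1-8)])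
  ultimately show ?thesis by auto
qed

section \<open>Bounds for isotropic vectors\<close>

text \<open>The span of \<open>M\<close> is isotropic and contains the zero vector, which
  \<open>M\<close> omits; this makes the inequality strict.\<close>

lemma card_isotropic_less:
  assumes "subspace W" "witt_le W w" "M \<subseteq> W" "isotropic M" "0\<^sub>v n \<notin> M"
  shows "card M < q ^ w"
proof -
  have MV: "M \<subseteq> V" using assms by (simp add: isotropic_def)
  have s: "subspace (span M)" using span_subspace[OF MV] .
  have "card (span M) \<le> q ^ w"
    using assms s span_isotropic span_minimal unfolding witt_le_def by blast
  moreover have "M \<subset> span M" using span_superset[of M] subspaceD[OF s] assms by blast
  then have "card M < card (span M)" using psubset_card_mono finite_subspace[OF s] by blast
  ultimately show ?thesis by simp
qed

text \<open>\<open>M\<close> avoids the hyperplane of its span that is orthogonal to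
  \<open>x\<close>, so it fits into a fraction \<open>(q - 1) / q\<close> of an isotropic
  subspace.\<close>

lemma card_isotropic_neighbours:
  assumes "subspace W" "witt_le W (Suc w)" "M \<subseteq> W" "isotropic M"
    and x: "x \<in> V" "\<And>y. y \<in> M \<Longrightarrow> B x y \<noteq> 0"
  shows "card M \<le> (q - 1) * q ^ w"
proof (cases "M = {}")
  case False
  then obtain y where y: "y \<in> M" by blast
  have MV: "M \<subseteq> V" using assms by (simp add: isotropic_def)
  have s: "subspace (span M)" using span_subspace[OF MV] .
  have "card (span M) \<le> q ^ Suc w"
    using assms s span_isotropic span_minimal unfolding witt_le_def by blast
  moreover have c: "card (span M) = q * card (span M \<inter> perp {x})"
    using card_hyperplane[OF s x(1)] x(2)[OF y] y span_superset by blast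
  ultimately have le: "card (span M \<inter> perp {x}) \<le> q ^ w" using q_ge_2 by simp
  have "M \<subseteq> span M - (span M \<inter> perp {x})" using span_superset x by (auto simp: perp_def)
  then have "card M \<le> card (span M) - card (span M \<inter> perp {x})"
    using card_mono[of "span M - (span M \<inter> perp {x})" M] finite_subspace[OF s]
      card_Diff_subset[of "span M \<inter> perp {x}" "span M"] by simp
  also have "\<dots> = (q - 1) * card (span M \<inter> perp {x})" using c by (simp add: diff_mult_distrib)
  also have "\<dots> \<le> (q - 1) * q ^ w" using le by simp
  finally show ?thesis .
qed simp

text \<open>Two adjacent neighbours would form a triangle with \<open>x\<close>; the last hypothesis
  keeps \<open>x\<close> out of its own neighbourhood.\<close>

lemma isotropic_neighbours:
  assumes "triangle_free S" "Z \<subseteq> S" "x \<in> S" "\<And>z. z \<in> Z \<Longrightarrow> B z z = 0" "x \<notin> Z \<or> B x x = 0"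
  shows "isotropic {z \<in> Z. B x z \<noteq> 0}"
proof -
  have "B y z = 0" if "y \<in> Z" "z \<in> Z" "B x y \<noteq> 0" "B x z \<noteq> 0" for y z
  proof (cases "y = z")
    case False
    then show ?thesis using triangle_free_neighbours[of S x y z] assms that by blast
  qed (use assms that in simp)
  moreover have "Z \<subseteq> V" using assms by (auto simp: triangle_free_def)
  ultimately show ?thesis by (auto simp: isotropic_def)
qed

text \<open>Two non-orthogonal isotropic vectors span a hyperbolic plane, whose orthogonal complement
  has smaller Witt index.\<close>

lemma witt_le_hyperbolic:
  assumes W: "subspace W" "witt_le W (Suc w)" and z: "z1 \<in> W" "z2 \<in> W" "B z1 z1 = 0" "B z1 z2 \<noteq> 0"
  shows "witt_le (W \<inter> perp {z1, z2}) w"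
  unfolding witt_le_def
proof (intro allI impI)
  fix U assume U: "subspace U \<and> isotropic U \<and> U \<subseteq> W \<inter> perp {z1, z2}"
  \<comment> \<open>Adjoining \<open>z1\<close> keeps \<open>U\<close> isotropic, and
    \<open>z2\<close> then cuts out a hyperplane of the span that still contains
    \<open>U\<close>.\<close>
  let ?M = "insert z1 U"
  have V: "z1 \<in> V" "z2 \<in> V" "U \<subseteq> V" using z W subspaceD U by blast+
  have iso: "isotropic ?M"
    using U V z unfolding isotropic_def perp_def by (auto simp: B_sym subset_iff)
  have s: "subspace (span ?M)" using span_subspace[of ?M] V by simp
  have "card (span ?M) \<le> q ^ Suc w"
    using W U z s span_isotropic[OF iso] span_minimal[of W ?M] unfolding witt_le_def by auto
  moreover have "card (span ?M) = q * card (span ?M \<inter> perp {z2})"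
    using span_superset[of ?M] z V B_sym by (intro card_hyperplane[OF s]) auto
  ultimately have "card (span ?M \<inter> perp {z2}) \<le> q ^ w" using q_ge_2 by simp
  moreover have "U \<subseteq> span ?M \<inter> perp {z2}"
    using span_superset[of ?M] U by (auto simp: perp_def)
  then have "card U \<le> card (span ?M \<inter> perp {z2})" using finite_subspace[OF s] by (simp add: card_mono)
  ultimately show "card U \<le> q ^ w" by simp
qed

text \<open>Unless \<open>Z\<close> is isotropic, take an adjacent pair \<open>z1\<close>,
  \<open>z2\<close>. Each of the two has at most \<open>(q - 1) * q ^ w\<close> neighbours, and the
  remaining vectors lie in the complement of a hyperbolic plane, where induction gives at most
  \<open>2 * q ^ w - 2\<close>.\<close>

lemma card_triangle_free_isotropic:
  assumes "subspace W" "witt_le W w" "triangle_free Z" "Z \<subseteq> W" "0\<^sub>v n \<notin> Z"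
    and "\<And>z. z \<in> Z \<Longrightarrow> B z z = 0"
  shows "card Z + 2 \<le> 2 * q ^ w"
  using assms
proof (induction w arbitrary: W Z)
  case 0
  have "Z = {}"
  proof (rule ccontr)
    assume "Z \<noteq> {}"
    then obtain z where z: "z \<in> Z" by blast
    have "card {z} < q ^ 0"
      using 0 z by (intro card_isotropic_less[of W]) (auto simp: isotropic_def triangle_free_def)
    then show False by simp
  qed
  then show ?case by simp
next
  case (Suc w)
  have ZV: "Z \<subseteq> V" using Suc.prems by (simp add: triangle_free_def)
  show ?case
  proof (cases "isotropic Z")
    case True
    then show ?thesis using card_isotropic_less[of W "Suc w" Z] Suc.prems by simp
  next
    case False
    then obtain z1 z2 where z: "z1 \<in> Z" "z2 \<in> Z" "B z1 z2 \<noteq> 0" using ZV by (auto simp: isotropic_def)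
    let ?N = "\<lambda>x. {z \<in> Z. B x z \<noteq> 0}" and ?Z = "Z \<inter> perp {z1, z2}"
    have N: "card (?N x) \<le> (q - 1) * q ^ w" if "x \<in> Z" for x
      using Suc.prems that ZV isotropic_neighbours[of Z Z x]
      by (intro card_isotropic_neighbours[of W w _ x]) auto
    have "card ?Z + 2 \<le> 2 * q ^ w"
    proof (rule Suc.IH)
      show "subspace (W \<inter> perp {z1, z2})"
        using Suc.prems z ZV by (intro subspace_Int subspace_perp) auto
      show "witt_le (W \<inter> perp {z1, z2}) w"
        using Suc.prems z by (intro witt_le_hyperbolic) auto
    qed (use Suc.prems triangle_free_subset in auto)
    moreover have "Z = ?N z1 \<union> ?N z2 \<union> ?Z" using ZV by (auto simp: perp_def)
    then have "card Z \<le> card (?N z1) + card (?N z2) + card ?Z"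
      using card_Un_le[of "?N z1 \<union> ?N z2" ?Z] card_Un_le[of "?N z1" "?N z2"] by simp
    ultimately have "card Z + 2 \<le> 2 * ((q - 1) * q ^ w) + 2 * q ^ w"
      using N[OF z(1)] N[OF z(2)] by simp
    also have "\<dots> = 2 * (((q - 1) + 1) * q ^ w)" by (simp only: distrib_left distrib_right mult_1)
    also have "\<dots> = 2 * q ^ Suc w" using q_ge_2 by simp
    finally show ?thesis .
  qed
qed

section \<open>The discriminant of a space with an isotropic subspace of half dimension\<close>

text \<open>Choose \<open>x\<close> in \<open>U\<close> and \<open>y\<close> with
  \<open>B x y = 1\<close>; the part of \<open>U\<close> orthogonal to \<open>y\<close> has one
  dimension less and carries a system by induction.\<close>

lemma biorthogonal_system:
  assumes "subspace U" "isotropic U" "card U = q ^ k"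
  shows "\<exists>u v. (\<forall>i<k. u i \<in> U \<and> v i \<in> V) \<and>
    (\<forall>i<k. \<forall>j<k. B (u i) (v j) = (if i = j then 1 else 0))"
  using assms
proof (induction k arbitrary: U)
  case 0
  then show ?case by simp
next
  case (Suc k)
  have UV: "U \<subseteq> V" using subspaceD(1)[OF Suc.prems(1)] .
  have "card U > 1" using Suc.prems(3) q_ge_2 one_less_power[of q "Suc k"] by simp
  then have "U \<noteq> {0\<^sub>v n}" by auto
  then obtain x where x: "x \<in> U" "x \<noteq> 0\<^sub>v n" using subspaceD(2)[OF Suc.prems(1)] by auto
  then have xV: "x \<in> V" using UV by blast
  obtain y' where y': "y' \<in> V" "B x y' \<noteq> 0" using nondeg[OF xV x(2)] by blast
  define y where "y = inverse (B x y') \<cdot>\<^sub>v y'"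
  have y: "y \<in> V" "B x y = 1" using y' xV by (simp_all add: y_def B_smult_right)
  have yx: "B y x = 1" using y xV B_sym by simp
  let ?U = "U \<inter> perp {y}"
  have sub: "subspace ?U" using subspace_Int[OF Suc.prems(1) subspace_perp[of "{y}"]] y by simp
  have "card U = q * card ?U" using card_hyperplane[OF Suc.prems(1) y(1) x(1)] yx by simp
  then have "card ?U = q ^ k" using Suc.prems(3) q_ge_2 by simp
  moreover have "isotropic ?U" using Suc.prems(2) by (auto simp: isotropic_def)
  ultimately obtain u v where uv: "\<And>i. i < k \<Longrightarrow> u i \<in> ?U" "\<And>i. i < k \<Longrightarrow> v i \<in> V"
    "\<And>i j. i < k \<Longrightarrow> j < k \<Longrightarrow> B (u i) (v j) = (if i = j then 1 else 0)"
    using Suc.IH[OF sub] by blast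
  let ?u = "\<lambda>i. if i = k then x else u i"
  \<comment> \<open>The correction by a multiple of \<open>y\<close> makes \<open>v i\<close>
    orthogonal to \<open>x\<close>. Pairings with the old \<open>u j\<close> are unchanged, as these
    are orthogonal to \<open>y\<close>.\<close>
  let ?v = "\<lambda>i. if i = k then y else v i + (- B x (v i)) \<cdot>\<^sub>v y"
  have uV: "u i \<in> V" and uy: "B (u i) y = 0" if "i < k" for i
    using uv(1)[OF that] UV y B_sym by (auto simp: perp_def)
  have "\<forall>i<Suc k. ?u i \<in> U \<and> ?v i \<in> V"
    using uv x y by (auto simp: less_Suc_eq)
  moreover have "\<forall>i<Suc k. \<forall>j<Suc k. B (?u i) (?v j) = (if i = j then 1 else 0)"
    using uv(2,3) uV uy xV y by (auto simp: less_Suc_eq B_add_right B_smult_right)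
  ultimately show ?case by (intro exI[of _ ?u] exI[of _ ?v] conjI)
qed

text \<open>In the basis given by a biorthogonal system the Gram matrix is \<open>[[0, 1], [1, D]]\<close>.\<close>

lemma is_square_disc:
  assumes U: "subspace U" "isotropic U" "card U = q ^ k" and n: "n = 2 * k"
  shows "is_square ((- 1) ^ k * det A)"
proof -
  obtain u v where uv: "\<And>i. i < k \<Longrightarrow> u i \<in> U" "\<And>i. i < k \<Longrightarrow> v i \<in> V"
    "\<And>i j. i < k \<Longrightarrow> j < k \<Longrightarrow> B (u i) (v j) = (if i = j then 1 else 0)"
    using biorthogonal_system[OF U] by blast
  have uV: "u i \<in> V" if "i < k" for i using uv(1)[OF that] subspaceD(1)[OF U(1)] by blast
  have uu: "B (u i) (u j) = 0" if "i < k" "j < k" for i j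
    using uv(1) that U(2) by (auto simp: isotropic_def)
  have vu: "B (v j) (u i) = (if i = j then 1 else 0)" if "i < k" "j < k" for i j
    using uv(3)[OF that] B_sym[OF uV uv(2)] that by simp
  define p where "p j = (if j < k then u j else v (j - k))" for j
  define P where "P = mat n n (\<lambda>(i, j). p j $ i)"
  have pV: "p j \<in> V" if "j < n" for j using that uV uv(2) n by (auto simp: p_def)
  have P: "P \<in> carrier_mat n n" by (simp add: P_def)
  have colP: "col P j = p j" if "j < n" for j
    using pV[OF that] that by (intro eq_vecI) (auto simp: P_def)
  let ?G = "transpose_mat P * (A * P)" and ?D = "mat k k (\<lambda>(i, j). B (v i) (v j))"
  have AP: "A * P \<in> carrier_mat n n" using A_carrier P by simp
  have G: "?G $$ (i, j) = B (p i) (p j)" if "i < n" "j < n" for i j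
  proof -
    have "?G $$ (i, j) = row (transpose_mat P) i \<bullet> col (A * P) j"
      using that P AP by (intro index_mult_mat(1)) auto
    also have "\<dots> = col P i \<bullet> (A *\<^sub>v col P j)"
      using that P A_carrier by (simp add: row_transpose col_mult2[of A n n P n] mult_mat_vec_def)
    finally show ?thesis using that by (simp add: colP bilin_def)
  qed
  have "?G = four_block_mat (0\<^sub>m k k) (1\<^sub>m k) (1\<^sub>m k) ?D"
  proof (rule eq_matI)
    fix i j assume "i < dim_row (four_block_mat (0\<^sub>m k k) (1\<^sub>m k) (1\<^sub>m k) ?D)"
      "j < dim_col (four_block_mat (0\<^sub>m k k) (1\<^sub>m k) (1\<^sub>m k) ?D)"
    then have ij: "i < k + k" "j < k + k" by simp_all
    then have "?G $$ (i, j) = B (p i) (p j)" using G n by simp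
    then show "?G $$ (i, j) = four_block_mat (0\<^sub>m k k) (1\<^sub>m k) (1\<^sub>m k) ?D $$ (i, j)"
      using ij uv(3) uu vu by (auto simp: p_def index_mat_four_block)
  qed (use P n in auto)
  then have "det ?G = det (0\<^sub>m k k * ?D - 1\<^sub>m k * (1\<^sub>m k :: 'a mat))"
    using det_four_block_mat[of "0\<^sub>m k k" k "1\<^sub>m k" "1\<^sub>m k" ?D] by simp
  also have "0\<^sub>m k k * ?D - 1\<^sub>m k * (1\<^sub>m k :: 'a mat) = (- 1) \<cdot>\<^sub>m 1\<^sub>m k"
    by (rule eq_matI) auto
  also have "det \<dots> = (- 1) ^ k" by (simp add: det_smult)
  finally have detP: "det P * (det A * det P) = (- 1) ^ k"
    using P AP A_carrier by (simp add: det_mult[of _ n] det_transpose[OF P])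
  \<comment> \<open>Since the square of \<open>det P\<close> times \<open>det A\<close> is
    \<open>(- 1) ^ k\<close>, the signed determinant is the square of
    \<open>inverse (det P)\<close>.\<close>
  have "((- 1) ^ k * det A) * (det P)\<^sup>2 = (- 1) ^ k * (det P * (det A * det P))"
    by (simp add: power2_eq_square)
  also have "\<dots> = 1" unfolding detP by (simp add: power_mult_distrib[symmetric])
  finally have 1: "((- 1) ^ k * det A) * (det P)\<^sup>2 = 1" .
  then have "det P \<noteq> 0" by auto
  with 1 have "(- 1) ^ k * det A = (inverse (det P))\<^sup>2"
    by (simp add: field_simps power2_eq_square)
  then show ?thesis unfolding is_nth_power_def by blast
qed

section \<open>Non-isotropic vectors in the presence of isotropic ones\<close>

lemma zero_subspace: "subspace {0\<^sub>v n}" "perp {0\<^sub>v n} = V"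
  by (auto simp: subspace_def perp_def B_zero_left)

lemma card_V: "card V = q ^ n"
  by (simp add: card_carrier_vec_field card_field)

lemma card_nonisotropic:
  assumes X: "triangle_free X" "\<And>x. x \<in> X \<Longrightarrow> B x x \<noteq> 0"
  shows "2 * card X \<le> n * (n + 3)" and "n \<le> 2 \<Longrightarrow> card X \<le> 2 * n"
proof -
  have XV: "X \<subseteq> V" using X(1) by (simp add: triangle_free_def)
  have *: "{0\<^sub>v n} \<subseteq> V" "X \<subseteq> perp {0\<^sub>v n}" "card V \<le> card {0\<^sub>v n} * q ^ n"
    using XV zero_subspace by (simp_all add: card_V)
  show "2 * card X \<le> n * (n + 3)"
    by (rule card_triangle_free_nonisotropic[OF X(1) V_subspace XV zero_subspace(1) *(1,2) X(2) *(3)])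
  show "card X \<le> 2 * n" if "n \<le> 2"
    by (rule card_triangle_free_nonisotropic_small[OF X(1) V_subspace XV zero_subspace(1) *(1,2) X(2) *(3) that])
qed

text \<open>The neighbours of \<open>z\<close> in \<open>X\<close> are mutually orthogonal, so at
  most \<open>n\<close> in number. The others lie in \<open>perp {z}\<close>, which has codimension
  \<open>n - 2\<close> over the line of \<open>z\<close> in its radical, so the earlier bounds apply
  with \<open>m\<close> in place of \<open>n\<close>.\<close>

lemma card_nonisotropic_if_isotropic:
  assumes S: "triangle_free S" "X \<subseteq> S" "\<And>x. x \<in> X \<Longrightarrow> B x x \<noteq> 0"
    and z: "z \<in> S" "B z z = 0" "z \<noteq> 0\<^sub>v n" and n: "n = m + 2"
  shows "2 * card X \<le> 2 * n + m * (m + 3)" and "m \<le> 2 \<Longrightarrow> card X \<le> n + 2 * m"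
proof -
  have X: "triangle_free X" using S(1,2) by (rule triangle_free_subset)
  have SV: "S \<subseteq> V" using S(1) by (simp add: triangle_free_def)
  then have XV: "X \<subseteq> V" and zV: "z \<in> V" using S(2) z(1) by auto
  let ?N = "{x \<in> X. B z x \<noteq> 0}" and ?X = "X \<inter> perp {z}" and ?U = "span {z}"
  have N: "card ?N \<le> n"
  proof (rule card_orthogonal_nonisotropic_le[OF _ V_subspace _ zero_subspace(1)])
    show "B x y = 0" if xy: "x \<in> ?N" "y \<in> ?N" "x \<noteq> y" for x y
    proof (rule triangle_free_neighbours[OF S(1) z(1)])
      show "x \<in> S" "y \<in> S" "B z x \<noteq> 0" "B z y \<noteq> 0" using xy S(2) by auto
      show "z \<noteq> x" "z \<noteq> y" using xy z(2) by auto
    qed (rule xy)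
    show "?N \<subseteq> V" "?N \<subseteq> V" "?N \<subseteq> perp {0\<^sub>v n}" "{0\<^sub>v n} \<subseteq> V" "card V \<le> card {0\<^sub>v n} * q ^ n"
      using XV zero_subspace(2) by (auto simp: card_V)
    show "B x x \<noteq> 0" if "x \<in> ?N" for x using S(3) that by blast
  qed
  have iso: "isotropic {z}" using z zV by (simp add: isotropic_def)
  have U: "subspace ?U" "z \<in> ?U" using span_subspace[of "{z}"] span_superset[of "{z}"] zV by auto
  have perpU: "perp ?U = perp {z}" using perp_span[of "{z}"] zV by simp
  have UU: "?U \<subseteq> perp {z}" using span_isotropic[OF iso] perpU by (simp add: isotropic_iff)
  have sub: "subspace (perp {z})" using subspace_perp[of "{z}"] zV by simp
  have triX: "triangle_free ?X" using triangle_free_subset[OF X] by simp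
  obtain k where k: "card ?U = q ^ k" using card_subspace_power[OF U(1)] by blast
  have "card {z, 0\<^sub>v n} \<le> card ?U"
    using U subspaceD(2)[OF U(1)] finite_subspace by (intro card_mono) auto
  then have "k \<noteq> 0" using k z by (intro notI) simp
  then have qU: "q \<le> card ?U" using k q_ge_2 by (simp add: self_le_power)
  have "q * (q * card (perp {z})) \<le> q * (card ?U * card (perp {z}))" using qU by simp
  also have "\<dots> = q * q ^ n" using card_perp[OF U(1)] perpU by simp
  finally have "q * card (perp {z}) \<le> q * (q * q ^ m)" using q_ge_2 n by simp
  then have "card (perp {z}) \<le> q * q ^ m" using q_ge_2 by simp
  also have "\<dots> \<le> card ?U * q ^ m" using qU by simp
  finally have c: "card (perp {z}) \<le> card ?U * q ^ m" .
  have "X = ?N \<union> ?X" using XV by (auto simp: perp_def)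
  then have "card X \<le> card ?N + card ?X" using card_Un_le[of ?N ?X] by simp
  then have le: "card X \<le> n + card ?X" using N by simp
  have sX: "?X \<subseteq> perp {z}" "?X \<subseteq> perp ?U" using perpU by auto
  have aX: "B x x \<noteq> 0" if "x \<in> ?X" for x using S(3) that by simp
  show "2 * card X \<le> 2 * n + m * (m + 3)"
    using le card_triangle_free_nonisotropic[OF triX sub sX(1) U(1) UU sX(2) aX c] by simp
  show "card X \<le> n + 2 * m" if "m \<le> 2"
    using le card_triangle_free_nonisotropic_small[OF triX sub sX(1) U(1) UU sX(2) aX c that] by simp
qed

text \<open>Below \<open>U1\<close> and \<open>U2\<close> are maximal isotropic subspaces which contain all but a few of the
  isotropic vectors of \<open>S\<close>. As \<open>perp Ui\<close> has codimension at most \<open>c\<close> over its radical \<open>Ui\<close>, only few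
  non-isotropic vectors fit into each of \<open>perp U1\<close> and \<open>perp U2\<close>.\<close>

lemma card_nonisotropic_le_if_many_isotropic:
  assumes S: "triangle_free S" "0\<^sub>v n \<notin> S" and w: "witt_le V (Suc w)" and n: "n = 2 * Suc w + c" "c \<le> 2"
    and many: "q ^ Suc w + 3 * q ^ w < card {z \<in> S. B z z = 0} + 4"
    and z: "z1 \<in> S" "z2 \<in> S" "B z1 z1 = 0" "B z2 z2 = 0" "B z1 z2 \<noteq> 0"
  shows "card {x \<in> S. B x x \<noteq> 0} \<le> 3 * c"
proof -
  define Z where "Z = {z \<in> S. B z z = 0}"
  define X where "X = {x \<in> S. B x x \<noteq> 0}"
  \<comment> \<open>The indices are crossed: \<open>M1\<close> consists of the neighbours of
    \<open>z2\<close> and so contains \<open>z1\<close>, and vice versa.\<close>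
  define M1 where "M1 = {z \<in> Z. B z2 z \<noteq> 0}"
  define M2 where "M2 = {z \<in> Z. B z1 z \<noteq> 0}"
  define U1 where "U1 = span M1"
  define U2 where "U2 = span M2"
  define e where "e = q ^ w"
  have SV: "S \<subseteq> V" using S by (simp add: triangle_free_def)
  have ZS: "Z \<subseteq> S" "\<And>z. z \<in> Z \<Longrightarrow> B z z = 0" and ZV: "Z \<subseteq> V" using SV by (auto simp: Z_def)
  have zZ: "z1 \<in> Z" "z2 \<in> Z" and zV: "z1 \<in> V" "z2 \<in> V" using z SV by (auto simp: Z_def)
  have MV: "M1 \<subseteq> V" "M2 \<subseteq> V" and fM: "finite M1" "finite M2"
    using ZV finite_V by (auto simp: M1_def M2_def)
  have epos: "e \<ge> 1" using q_ge_2 by (simp add: e_def)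
  have big: "q * e + 3 * e < card Z + 4" using many by (simp add: e_def Z_def)
  have iso_N: "isotropic {y \<in> Z. B x y \<noteq> 0}" if "x \<in> S" for x
    using isotropic_neighbours[OF S(1) ZS(1) that ZS(2)] ZS(2) by blast
  have card_N: "card {y \<in> Z. B x y \<noteq> 0} + e \<le> q * e" if x: "x \<in> S" for x
  proof -
    have "card {y \<in> Z. B x y \<noteq> 0} \<le> (q - 1) * q ^ w"
      using ZV SV x by (intro card_isotropic_neighbours[OF V_subspace w _ iso_N[OF x], of x]) auto
    moreover have "(q - 1) * q ^ w + q ^ w = ((q - 1) + 1) * q ^ w" by (simp only: distrib_right mult_1)
    ultimately show ?thesis using q_ge_2 by (simp add: e_def)
  qed
  have M: "card M1 + e \<le> q * e" "card M2 + e \<le> q * e"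
    using card_N[OF z(2)] card_N[OF z(1)] by (simp_all add: M1_def M2_def)
  have "card (Z \<inter> perp {z1, z2}) + 2 \<le> 2 * q ^ w"
  proof (rule card_triangle_free_isotropic)
    show "subspace (V \<inter> perp {z1, z2})" using V_subspace zV by (intro subspace_Int subspace_perp) auto
    show "witt_le (V \<inter> perp {z1, z2}) w" by (rule witt_le_hyperbolic[OF V_subspace w zV z(3,5)])
    show "triangle_free (Z \<inter> perp {z1, z2})" using S(1) by (rule triangle_free_subset) (use ZS in blast)
  qed (use ZS ZV S(2) in auto)
  moreover have "Z = M1 \<union> M2 \<union> (Z \<inter> perp {z1, z2})"
    using ZV by (auto simp: M1_def M2_def perp_def)
  then have "card Z \<le> card M1 + card M2 + card (Z \<inter> perp {z1, z2})"
    using card_Un_le[of "M1 \<union> M2" "Z \<inter> perp {z1, z2}"] card_Un_le[of M1 M2] by simp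
  ultimately have Zle: "card Z + 2 \<le> card M1 + card M2 + 2 * e" by (simp add: e_def)
  \<comment> \<open>The threshold \<open>2 * e - 2\<close> is what two hyperplane sections of an
    isotropic subspace of size \<open>q * e\<close> can cover at most, as each has
    \<open>e - 1\<close> nonzero vectors.\<close>
  have M_large: "card M1 + 2 > 2 * e" "card M2 + 2 > 2 * e" using M Zle big by linarith+
  have M_sum: "card M1 + card M2 + 2 > q * e + e" using Zle big by linarith
  have iso: "isotropic M1" "isotropic M2"
    using iso_N[OF z(2)] iso_N[OF z(1)] by (simp_all add: M1_def M2_def)
  \<comment> \<open>A subspace of at most \<open>q ^ w\<close> vectors has too few nonzero ones to
    contain \<open>M\<close>, so the span has the maximal size.\<close>
  have card_U: "card (span M) = q * e"
    if M: "isotropic M" "M \<subseteq> Z" "card M + 2 > 2 * e" for M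
  proof -
    have MV: "M \<subseteq> V" and s: "subspace (span M)" using M ZV span_subspace by auto
    obtain k where k: "card (span M) = q ^ k" using card_subspace_power[OF s] by blast
    have "card (span M) \<le> q ^ Suc w"
      using w s span_isotropic[OF M(1)] subspaceD(1)[OF s] unfolding witt_le_def by blast
    then have "k \<le> Suc w" using k q_ge_2 by (simp add: power_le_imp_le_exp del: power_Suc)
    moreover have "\<not> k \<le> w"
    proof
      assume "k \<le> w"
      then have "q ^ k \<le> e" unfolding e_def using q_ge_2 by (intro power_increasing) auto
      moreover have "M \<subset> span M"
        using span_superset[of M] subspaceD(2)[OF s] M ZS S(2) by blast
      then have "card M < card (span M)" using psubset_card_mono finite_subspace[OF s] by blast
      ultimately show False using M(3) k by linarith
    qed
    ultimately have "k = Suc w" by simp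
    then show ?thesis using k by (simp add: e_def)
  qed
  have cU: "card U1 = q * e" "card U2 = q * e"
    using card_U iso M_large by (simp_all add: U1_def U2_def M1_def M2_def)
  have sU: "subspace U1" "subspace U2" using span_subspace MV by (simp_all add: U1_def U2_def)
  have card_perp_M: "card (M \<inter> perp {x}) + 1 \<le> e"
    if M: "isotropic M" "M \<subseteq> Z" "card M + 2 > 2 * e" and x: "x \<in> V" "x \<notin> perp (span M)" for M x
  proof -
    have MV: "M \<subseteq> V" and s: "subspace (span M)" using M ZV span_subspace by auto
    obtain y where y: "y \<in> span M" "B y x \<noteq> 0" using x by (auto simp: perp_def)
    then have "y \<in> V" using subspaceD(1)[OF s] by blast
    then have "card (span M) = q * card (span M \<inter> perp {x})"
      using card_hyperplane[OF s x(1) y(1)] y(2) x(1) B_sym by simp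
    then have c: "card (span M \<inter> perp {x}) = e" using card_U[OF M] q_ge_2 by simp
    have "0\<^sub>v n \<in> span M \<inter> perp {x}" using subspaceD(2)[OF s] x by (simp add: perp_def B_zero_right)
    moreover have "0\<^sub>v n \<notin> M" using M(2) ZS(1) S(2) by blast
    ultimately have "M \<inter> perp {x} \<subset> span M \<inter> perp {x}" using span_superset[of M] by blast
    then have "card (M \<inter> perp {x}) < e"
      using psubset_card_mono[of "span M \<inter> perp {x}"] finite_subspace[OF s] c by simp
    then show ?thesis by simp
  qed
  have MZ: "M1 \<subseteq> Z" "M2 \<subseteq> Z" by (auto simp: M1_def M2_def)
  have XS: "X \<subseteq> S" and XV: "X \<subseteq> V" and aX: "\<And>x. x \<in> X \<Longrightarrow> B x x \<noteq> 0" using SV by (auto simp: X_def)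
  have disj: "M1 \<inter> M2 = {}"
  proof -
    have False if "m \<in> M1" "m \<in> M2" for m
    proof -
      have m: "m \<in> S" "B z1 m \<noteq> 0" "B z2 m \<noteq> 0" using that ZS by (auto simp: M1_def M2_def)
      then have "z1 \<noteq> m" "z2 \<noteq> m" "z1 \<noteq> z2" using z by auto
      then show False using triangle_freeD[OF S(1) z(1,2) m(1)] m z by blast
    qed
    then show ?thesis by blast
  qed
  \<comment> \<open>Otherwise at most \<open>e - 1\<close> vectors of each of \<open>M1\<close> and
    \<open>M2\<close> are orthogonal to \<open>x\<close>, and by \<open>M_sum\<close> more than
    \<open>q * e - e\<close> are adjacent to it, contradicting \<open>card_N\<close>.\<close>
  have cover: "x \<in> perp U1 \<or> x \<in> perp U2" if x: "x \<in> X" for x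
  proof (rule ccontr)
    assume "\<not> (x \<in> perp U1 \<or> x \<in> perp U2)"
    then have no: "x \<notin> perp U1" "x \<notin> perp U2" by auto
    have xV: "x \<in> V" and xS: "x \<in> S" using x XV XS by auto
    have 1: "card (M1 \<inter> perp {x}) + 1 \<le> e"
      using card_perp_M[OF iso(1) MZ(1) M_large(1) xV] no(1) by (simp add: U1_def)
    have 2: "card (M2 \<inter> perp {x}) + 1 \<le> e"
      using card_perp_M[OF iso(2) MZ(2) M_large(2) xV] no(2) by (simp add: U2_def)
    let ?N = "{y \<in> Z. B x y \<noteq> 0}"
    have split: "card (M1 \<union> M2) = card M1 + card M2" using card_Un_disjoint[OF fM disj] .
    have "M1 \<union> M2 \<subseteq> (M1 \<inter> perp {x}) \<union> (M2 \<inter> perp {x}) \<union> ?N"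
      using MZ ZV by (auto simp: perp_def)
    then have "card (M1 \<union> M2) \<le> card ((M1 \<inter> perp {x}) \<union> (M2 \<inter> perp {x}) \<union> ?N)"
      using fM finite_V[OF ZV] by (intro card_mono) auto
    also have "\<dots> \<le> card (M1 \<inter> perp {x}) + card (M2 \<inter> perp {x}) + card ?N"
      using card_Un_le[of "(M1 \<inter> perp {x}) \<union> (M2 \<inter> perp {x})" ?N]
        card_Un_le[of "M1 \<inter> perp {x}" "M2 \<inter> perp {x}"] by linarith
    finally show False using split 1 2 card_N[OF xS] M_sum by linarith
  qed
  \<comment> \<open>Adjacent \<open>x\<close> and \<open>y\<close> have no common neighbour, so
    \<open>M\<close> would be covered by two hyperplane sections, which is impossible for its
    size.\<close>
  have orth: "B x y = 0"
    if M: "isotropic M" "M \<subseteq> Z" "card M + 2 > 2 * e"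
      and x: "x \<in> X" "x \<notin> perp (span M)" and y: "y \<in> X" "y \<notin> perp (span M)" and "x \<noteq> y" for M x y
  proof (rule ccontr)
    assume xy: "B x y \<noteq> 0"
    have V: "x \<in> V" "y \<in> V" and xyS: "x \<in> S" "y \<in> S" using x y XV XS by auto
    have "B x m = 0 \<or> B y m = 0" if "m \<in> M" for m
    proof -
      have m: "m \<in> S" "B m m = 0" using that M ZS by auto
      then have "x \<noteq> m" "y \<noteq> m" using aX x y by auto
      then show ?thesis using triangle_freeD[OF S(1) xyS m(1)] \<open>x \<noteq> y\<close> xy by blast
    qed
    then have "M \<subseteq> (M \<inter> perp {x}) \<union> (M \<inter> perp {y})" using M ZV by (auto simp: perp_def)
    then have "card M \<le> card ((M \<inter> perp {x}) \<union> (M \<inter> perp {y}))"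
      using finite_V M(2) ZV by (intro card_mono) auto
    also have "\<dots> \<le> card (M \<inter> perp {x}) + card (M \<inter> perp {y})" by (rule card_Un_le)
    finally show False using card_perp_M[OF M V(1) x(2)] card_perp_M[OF M V(2) y(2)] M(3) by linarith
  qed
  have radical: "U \<subseteq> perp U" "card (perp U) \<le> card U * q ^ c" "subspace (perp U)"
    if "subspace U" "isotropic U" "card U = q * e" for U
  proof -
    show "U \<subseteq> perp U" using that(2) by (simp add: isotropic_iff)
    show "subspace (perp U)" using subspace_perp subspaceD(1)[OF that(1)] by blast
    have "q ^ n = q ^ (Suc w + (Suc w + c))" by (simp add: n mult_2 add.assoc)
    also have "\<dots> = (q * e) * ((q * e) * q ^ c)" by (simp only: power_add power_Suc e_def)
    finally have "(q * e) * card (perp U) = (q * e) * ((q * e) * q ^ c)"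
      using card_perp[OF that(1)] that(3) by simp
    then show "card (perp U) \<le> card U * q ^ c" using that(3) q_ge_2 epos by simp
  qed
  have isoU: "isotropic U1" "isotropic U2" using span_isotropic iso by (simp_all add: U1_def U2_def)
  note rad1 = radical[OF sU(1) isoU(1) cU(1)] and rad2 = radical[OF sU(2) isoU(2) cU(2)]
  have triX: "triangle_free Y" if "Y \<subseteq> X" for Y using triangle_free_subset[OF S(1)] XS that by blast
  have fX: "finite X" using finite_V[OF XV] .
  have both: "card (X \<inter> perp U) \<le> 2 * c" if U: "subspace U" "isotropic U" "card U = q * e" for U
  proof -
    note r = radical[OF U]
    have sub: "X \<inter> perp U \<subseteq> perp U" by simp
    have "B x x \<noteq> 0" if "x \<in> X \<inter> perp U" for x using aX that by simp
    from card_triangle_free_nonisotropic_small[OF triX r(3) sub U(1) r(1) sub this r(2) n(2)]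
    show ?thesis by simp
  qed
  have only: "card ((X \<inter> perp U) - perp (span M)) \<le> c"
    if U: "subspace U" "isotropic U" "card U = q * e" 
      and M: "isotropic M" "M \<subseteq> Z" "card M + 2 > 2 * e" for U M
  proof -
    note r = radical[OF U]
    let ?Y = "(X \<inter> perp U) - perp (span M)"
    have sub: "?Y \<subseteq> V" "?Y \<subseteq> perp U" using XV by auto
    have a: "B x x \<noteq> 0" if "x \<in> ?Y" for x using aX that by simp
    have "B x y = 0" if "x \<in> ?Y" "y \<in> ?Y" "x \<noteq> y" for x y
      using orth[OF M, of x y] that by simp
    from card_orthogonal_nonisotropic_le[OF sub(1) r(3) sub(2) U(1) r(1) sub(2) a this r(2)]
    show ?thesis by simp
  qed
  let ?X1 = "(X \<inter> perp U1) - perp U2" and ?X2 = "(X \<inter> perp U2) - perp U1"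
  let ?X12 = "X \<inter> perp U1 \<inter> perp U2"
  \<comment> \<open>The bound \<open>3 * c\<close> splits as \<open>c + 2 * c\<close>:
    \<open>?X1\<close> is mutually orthogonal by \<open>orth\<close>, and everything else lies in
    \<open>perp U2\<close>.\<close>
  have "X = ?X1 \<union> ?X2 \<union> ?X12" using cover by blast
  then have "card X \<le> card ?X1 + card ?X2 + card ?X12"
    using card_Un_le[of "?X1 \<union> ?X2" ?X12] card_Un_le[of ?X1 ?X2] by simp
  moreover have "card ?X1 \<le> c" "card ?X2 \<le> c"
    using only[OF sU(1) isoU(1) cU(1) iso(2) MZ(2) M_large(2)]
      only[OF sU(2) isoU(2) cU(2) iso(1) MZ(1) M_large(1)] by (simp_all add: U1_def U2_def)
  moreover have "card ?X1 + card ?X12 = card (X \<inter> perp U1)"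
    using fX by (subst card_Un_disjoint[symmetric]) (auto intro: arg_cong[of _ _ card])
  moreover have "card ?X2 + card ?X12 = card (X \<inter> perp U2)"
    using fX by (subst card_Un_disjoint[symmetric]) (auto intro: arg_cong[of _ _ card])
  moreover note both[OF sU(1) isoU(1) cU(1)] both[OF sU(2) isoU(2) cU(2)]
  ultimately show ?thesis unfolding X_def[symmetric] by linarith
qed

section \<open>Combining the bounds for isotropic and non-isotropic vectors\<close>

text \<open>Settles sets without isotropic vectors. For \<open>w = 0\<close> the bound
  \<open>2 * n\<close> contradicts \<open>large\<close>; for larger \<open>w\<close> the quadratic
  bound stays below \<open>2 * q ^ w\<close>.\<close>

lemma card_nonisotropic_bound:
  assumes q: "q \<ge> 7" and X: "triangle_free X" "\<And>x. x \<in> X \<Longrightarrow> B x x \<noteq> 0"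
    and n: "n = 2 * w + c" "c \<le> 2" and large: "card X > 3 * c"
  shows "card X + 2 \<le> 2 * q ^ w + 3 * c"
proof (cases w)
  case 0
  then show ?thesis using card_nonisotropic(2)[OF X] n large by simp
next
  case (Suc k)
  have c: "c = 0 \<or> c = 1 \<or> c = 2" using n by auto
  have X2: "2 * card X \<le> n * (n + 3)" by (rule card_nonisotropic(1)[OF X])
  have qk: "7 * 7 ^ k \<le> q ^ w" using power_mono[OF q, of w] Suc by simp
  show ?thesis
  proof (cases "k = 0")
    case True
    then show ?thesis using c X2 qk n Suc by auto
  next
    case False
    then have "4 * (k * k) + 22 * k + 30 \<le> 8 * 7 ^ k" using quadratic_le_power_7 by simp
    moreover have "n * (n + 3) \<le> 4 * (k * k) + 22 * k + 28"
    proof -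
      have "n * (n + 3) \<le> (2 * k + 4) * (2 * k + 7)" using n Suc by (intro mult_le_mono) auto
      then show ?thesis by (simp add: algebra_simps)
    qed
    ultimately show ?thesis using X2 qk by linarith
  qed
qed

text \<open>Shaped to be added to \<open>card Z + 4 \<le> q ^ Suc w + 3 * q ^ w\<close>: the terms
  \<open>3 * q ^ w\<close> cancel and the final bound remains.\<close>

lemma card_nonisotropic_if_isotropic_bound:
  assumes q: "q \<ge> 7" and S: "triangle_free S" "X \<subseteq> S" "\<And>x. x \<in> X \<Longrightarrow> B x x \<noteq> 0"
    and z: "z \<in> S" "B z z = 0" "z \<noteq> 0\<^sub>v n" and n: "n = 2 * Suc w + c" "c \<le> 2"
  shows "card X + 3 * q ^ w \<le> q ^ Suc w + 2 + 3 * c"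
proof -
  define m where "m = 2 * w + c"
  have nm: "n = m + 2" by (simp add: m_def n)
  have q4: "7 * q ^ w \<le> q ^ Suc w" using q by simp
  have qw: "7 ^ w \<le> q ^ w" using power_mono[OF q, of w] by simp
  \<comment> \<open>The room available is \<open>q ^ Suc w - 3 * q ^ w\<close>, which is at least
    \<open>4 * 7 ^ w\<close>.\<close>
  have "card X \<le> 4 * 7 ^ w + 2 + 3 * c"
  proof (cases "w = 0")
    case True
    then show ?thesis
      using card_nonisotropic_if_isotropic(2)[OF S z nm] n by (simp add: m_def)
  next
    case False
    have "2 * card X \<le> 2 * n + m * (m + 3)"
      by (rule card_nonisotropic_if_isotropic(1)[OF S z nm])
    also have "\<dots> = m * (m + 5) + 4" by (simp add: nm algebra_simps)
    also have "\<dots> \<le> (2 * w + 2) * (2 * w + 7) + 4"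
      using n by (intro add_le_mono1 mult_le_mono) (auto simp: m_def)
    also have "\<dots> \<le> 4 * (w * w) + 22 * w + 30" by (simp add: algebra_simps)
    also have "\<dots> \<le> 8 * 7 ^ w" using quadratic_le_power_7 False by simp
    finally show ?thesis by simp
  qed
  then show ?thesis using q4 qw by linarith
qed

text \<open>If \<open>X\<close> has at most \<open>3 * c\<close> elements, the isotropic bound
  suffices. A larger \<open>X\<close> either stands alone or, by the contrapositive of
  \<open>card_nonisotropic_le_if_many_isotropic\<close>, forces \<open>Z\<close> to be small enough
  to compensate.\<close>

lemma card_triangle_free_le:
  assumes q: "q \<ge> 7" and w: "witt_le V w" and n: "n = 2 * w + c" "c \<le> 2"
    and S: "triangle_free S" "0\<^sub>v n \<notin> S"
  shows "card S + 2 \<le> 2 * q ^ w + 3 * c"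
proof -
  define Z where "Z = {z \<in> S. B z z = 0}"
  define X where "X = {x \<in> S. B x x \<noteq> 0}"
  have SV: "S \<subseteq> V" using S(1) by (simp add: triangle_free_def)
  have fin: "finite Z" "finite X" using finite_V[OF SV] by (simp_all add: Z_def X_def)
  have ZS: "Z \<subseteq> S" "Z \<subseteq> V" "0\<^sub>v n \<notin> Z" and ZZ: "\<And>z. z \<in> Z \<Longrightarrow> B z z = 0"
    using S SV by (auto simp: Z_def)
  have XS: "X \<subseteq> S" and XX: "\<And>x. x \<in> X \<Longrightarrow> B x x \<noteq> 0" by (auto simp: X_def)
  have "S = Z \<union> X" "Z \<inter> X = {}" by (auto simp: Z_def X_def)
  then have S_eq: "card S = card Z + card X" using fin by (simp add: card_Un_disjoint)
  have Z: "card Z + 2 \<le> 2 * q ^ w"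
    by (rule card_triangle_free_isotropic[OF V_subspace w triangle_free_subset[OF S(1) ZS(1)] ZS(2,3) ZZ])
  consider "card X \<le> 3 * c" | "Z = {}" "card X > 3 * c" | z where "z \<in> Z" "card X > 3 * c"
    by fastforce
  then show ?thesis
  proof cases
    case 1
    then show ?thesis using Z S_eq by simp
  next
    case 2
    then show ?thesis
      using card_nonisotropic_bound[OF q triangle_free_subset[OF S(1) XS] XX n] S_eq by simp
  next
    case 3
    have "card Z > 0" using 3 fin by (auto simp: card_gt_0_iff)
    then obtain k where k: "w = Suc k" using Z by (cases w) auto
    have qk: "q ^ k \<ge> 1" using q by simp
    have "card Z + 4 \<le> q ^ Suc k + 3 * q ^ k"
    proof (cases "isotropic Z")
      case True
      then have "card Z < q ^ w" using card_isotropic_less[OF V_subspace w ZS(2)] ZS by blast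
      then show ?thesis using k qk by simp
    next
      case False
      then obtain z1 z2 where z: "z1 \<in> Z" "z2 \<in> Z" "B z1 z2 \<noteq> 0" using ZS by (auto simp: isotropic_def)
      show ?thesis
      proof (rule ccontr)
        assume "\<not> ?thesis"
        then have many: "q ^ Suc k + 3 * q ^ k < card {z \<in> S. B z z = 0} + 4" by (simp add: Z_def)
        have zS: "z1 \<in> S" "z2 \<in> S" "B z1 z1 = 0" "B z2 z2 = 0" using z ZS ZZ by blast+
        have "card {x \<in> S. B x x \<noteq> 0} \<le> 3 * c"
          by (rule card_nonisotropic_le_if_many_isotropic
              [OF S w[unfolded k] n[unfolded k] many zS z(3)])
        then show False using 3 by (simp add: X_def)
      qed
    qed
    moreover have "card X + 3 * q ^ k \<le> q ^ Suc k + 2 + 3 * c"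
    proof (rule card_nonisotropic_if_isotropic_bound[OF q S(1) XS XX _ ZZ _ n[unfolded k]])
      show "z \<in> S" "z \<noteq> 0\<^sub>v n" using 3(1) ZS by auto
    qed (use 3 in simp_all)
    ultimately show ?thesis using S_eq k by simp
  qed
qed

section \<open>Witt index from dimension and discriminant, and the four cases\<close>

text \<open>An isotropic \<open>U\<close> lies in \<open>perp U\<close>, so the square of its
  cardinality is at most \<open>q ^ n\<close>.\<close>

lemma card_isotropic_le:
  assumes "subspace U" "isotropic U" shows "\<exists>k. card U = q ^ k \<and> 2 * k \<le> n"
proof -
  obtain k where k: "card U = q ^ k" using card_subspace_power assms by blast
  have "U \<subseteq> perp U" using assms by (simp add: isotropic_iff)
  then have "card U \<le> card (perp U)"
    using card_mono finite_subspace subspace_perp subspaceD(1)[OF assms(1)] by meson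
  then have "card U * card U \<le> q ^ n" using card_perp[OF assms(1)] mult_le_mono2 by metis
  then have "q ^ (2 * k) \<le> q ^ n" by (simp add: k mult_2 power_add)
  then show ?thesis using k q_ge_2 by (auto dest: power_le_imp_le_exp[rotated])
qed

lemma witt_le_half: "witt_le V (n div 2)"
  unfolding witt_le_def
proof (intro allI impI, elim conjE)
  fix U assume "subspace U" "isotropic U"
  then obtain k where "card U = q ^ k" "2 * k \<le> n" using card_isotropic_le by blast
  then show "card U \<le> q ^ (n div 2)" using q_ge_2 by (simp add: power_increasing)
qed

text \<open>By \<open>is_square_disc\<close> an isotropic subspace of dimension
  \<open>n div 2\<close> would make the signed determinant a square.\<close>

lemma witt_le_nonsquare_disc:
  assumes "even n" "\<not> is_square ((- 1) ^ (n div 2) * det A)"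
  shows "witt_le V (n div 2 - 1)"
  unfolding witt_le_def
proof (intro allI impI, elim conjE)
  fix U assume U: "subspace U" "isotropic U"
  then obtain k where k: "card U = q ^ k" "2 * k \<le> n" using card_isotropic_le by blast
  have "k \<noteq> n div 2" using is_square_disc[OF U k(1)] assms by auto
  then have "k \<le> n div 2 - 1" using k(2) by simp
  then show "card U \<le> q ^ (n div 2 - 1)" using q_ge_2 k(1) by (simp add: power_increasing)
qed

end

theorem theorem2p1:
  fixes n q :: nat
    and \<gamma> :: "'a::{field,finite}"
    and A :: "'a mat"
    and S :: "'a vec set"
  assumes "CARD('a) = q" and "odd q" and "q \<ge> 7"
    and "\<not> is_square \<gamma>"
    and "nondegenerate_symmetric n A"
    and "three_two_orthogonal n A S"
  shows "(odd n \<longrightarrow> int (card S) \<le> 2 * int q ^ ((n - 1) div 2) + 1) \<and>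
         (even n \<and> form_eps \<gamma> n A = 1 \<longrightarrow> int (card S) \<le> 2 * int q ^ (n div 2) - 2) \<and>
         (n \<ge> 4 \<and> even n \<and> form_eps \<gamma> n A = \<gamma> \<longrightarrow> int (card S) \<le> 2 * int q ^ (n div 2 - 1) + 4) \<and>
         (n = 2 \<and> form_eps \<gamma> n A = \<gamma> \<longrightarrow> int (card S) \<le> 4)"
proof -
  interpret bilinear_space n q A by unfold_locales (rule assms)+
  have S0: "0\<^sub>v n \<notin> S" and S: "triangle_free S"
    using assms(6) by (auto simp: three_two_orthogonal_def orthogonal_vecs_def triangle_free_def)
  \<comment> \<open>As 1 is a square, it differs from \<open>\<gamma>\<close>, so the first branch
    of \<open>form_eps\<close> fails; the sign \<open>(- 1) ^ (n div 2)\<close> merges its two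
    parity cases.\<close>
  have nonsquare: "\<not> is_square ((- 1) ^ (n div 2) * det A)" if "form_eps \<gamma> n A = \<gamma>"
  proof -
    have "\<gamma> \<noteq> 1" using assms(4) by auto
    then show ?thesis using that by (cases "even (n div 2)") (auto simp: form_eps_def Let_def)
  qed
  \<comment> \<open>The additive constant \<open>3 * c - 2\<close> is -2, 1 or 4 for
    \<open>c\<close> equal to 0, 1 or 2.\<close>
  have int_le: "int (card S) \<le> 2 * int q ^ w - 2 + 3 * int c"
    if "n = 2 * w + c" "c \<le> 2" "witt_le V w" for w c
  proof -
    have "int (card S + 2) \<le> int (2 * q ^ w + 3 * c)"
      using card_triangle_free_le[OF assms(3) that(3,1,2) S S0] by (simp only: of_nat_le_iff)
    then show ?thesis by simp
  qed
  show ?thesis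
  proof (intro conjI impI)
    assume "odd n"
    then have "n = 2 * (n div 2) + 1" "(n - 1) div 2 = n div 2" by (auto elim: oddE)
    then show "int (card S) \<le> 2 * int q ^ ((n - 1) div 2) + 1"
      using int_le[of "n div 2" 1] witt_le_half by simp
  next
    assume "even n \<and> form_eps \<gamma> n A = 1"
    then show "int (card S) \<le> 2 * int q ^ (n div 2) - 2"
      using int_le[of "n div 2" 0] witt_le_half by simp
  next
    assume n: "n \<ge> 4 \<and> even n \<and> form_eps \<gamma> n A = \<gamma>"
    then have "n = 2 * (n div 2 - 1) + 2" by auto
    then show "int (card S) \<le> 2 * int q ^ (n div 2 - 1) + 4"
      using int_le[of "n div 2 - 1" 2] witt_le_nonsquare_disc nonsquare n by simp
  next
    \<comment> \<open>Here \<open>int_le\<close> with \<open>w = 0\<close> and \<open>c = 2\<close>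
      would only give 6. Witt index 0 rules out isotropic vectors, so the bound \<open>2 * n\<close>
      for non-isotropic ones applies.\<close>
    assume n: "n = 2 \<and> form_eps \<gamma> n A = \<gamma>"
    then have w: "witt_le V 0" using witt_le_nonsquare_disc nonsquare by fastforce
    have "B x x \<noteq> 0" if "x \<in> S" for x
    proof
      assume "B x x = 0"
      then have "card {x} < q ^ 0"
        using that S S0 by (intro card_isotropic_less[OF V_subspace w]) (auto simp: isotropic_def triangle_free_def)
      then show False by simp
    qed
    then show "int (card S) \<le> 4" using card_nonisotropic(2)[OF S] n by simp
  qed
qed

end
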